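(* Let $\Omega\subset\mathbb{R}^2$ be an open disk and let $\gamma\subset\mathbb{R}^2$ be the trace of a Jordan arc that divides $\Omega$ into two subsets $\Omega_1$ and $\Omega_2$. Let $P\in\gamma\cap\Omega$ be a point, not an endpoint of the arc, at which $\gamma$ is not smooth. Let $f_1,f_2\in C^1(\Omega)$ be continuously glued along $\gamma$, that is, let $$F(x,y):=\begin{cases} f_1(x,y) & \text{if } (x,y)\in\Omega_1,\\ f_2(x,y) & \text{if } (x,y)\in\Omega_2\end{cases}$$ be a continuous function on $\Omega$. Then $F$ is differentiable at $P$, that is, $\nabla f_1(P)=\nabla f_2(P)$.
   Context: A Jordan arc is a continuous injective (non-self-intersecting) map $\gamma:[a,b]\to\mathbb{R}^2$, and its trace, also denoted $\gamma$, is its image. Points $P$ at which smoothness is considered are images of interior points of the parameter interval; after reparametrization $P=\gamma(0)$ with $a<0<b$. Smoothness at a point: the trace $\gamma$ is smooth at $P=(x_0,y_0)$ if near $P$ it is the graph of a $C^1$ function, i.e., possibly after interchanging the two coordinates, there exist open intervals $I,J$ and a function $f\in C^1(I)$ such that $P=(x_0,f(x_0))\in I\times J$ and $\gamma\cap(I\times J)=\{(x,f(x)) : x\in I\}$. "$\gamma$ divides $\Omega$ into $\Omega_1$ and $\Omega_2$" means that $\Omega\setminus\gamma$ has exactly two connected components, that every point of $\gamma\cap\Omega$ lies in the boundary of both of them, and that $\Omega_1$ and $\Omega_2$ are these two components, with the points of the common boundary $\gamma\cap\Omega$ assigned to either. In particular, continuity of $F$ on $\Omega$ means that $f_1=f_2$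 on $\gamma\cap\Omega$. *)

theory Defs
  imports "HOL-Analysis.Analysis"
begin

text \<open>The plane is \<^typ>\<open>real \<times> real\<close>, whose product metric is the Euclidean one.\<close>

definition gradient :: "('a::real_inner \<Rightarrow> real) \<Rightarrow> 'a \<Rightarrow> 'a" where
  "gradient f p = (THE D. GDERIV f p :> D)"

lemma gradient_eqI:
  assumes "GDERIV f p :> D"
  shows "gradient f p = D"
proof -
  have "E = D" if "GDERIV f p :> E" for E
  proof -
    have "(\<lambda>h. inner h E) = (\<lambda>h. inner h D)"
      using has_derivative_unique that assms unfolding gderiv_def by blast
    then have "inner (E - D) E = inner (E - D) D"
      by metis
    then have "inner (E - D) (E - D) = 0"
      by (simp add: inner_diff_right)
    then show ?thesis
      by simp
  qed
  with assms show ?thesis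
    unfolding gradient_def by blast
qed

text \<open>Meant for open \<open>S\<close>: the derivatives are two-sided.\<close>

definition C1_on :: "('a::real_inner \<Rightarrow> real) \<Rightarrow> 'a set \<Rightarrow> bool" where
  "C1_on f S \<longleftrightarrow> (\<exists>G. (\<forall>p\<in>S. GDERIV f p :> G p) \<and> continuous_on S G)"

definition C1_graph_at :: "(real \<times> real) set \<Rightarrow> real \<times> real \<Rightarrow> bool" where
  "C1_graph_at \<Gamma> P \<longleftrightarrow>
     (\<exists>I J f. open I \<and> is_interval I \<and> open J \<and> is_interval J \<and>
        f C1_differentiable_on I \<and>
        P \<in> I \<times> J \<and> P = (fst P, f (fst P)) \<and>
        \<Gamma> \<inter> (I \<times> J) = {(x, f x) | x. x \<in> I})"

definition smooth_at :: "(real \<times> real) set \<Rightarrow> real \<times> real \<Rightarrow> bool" where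
  "smooth_at \<Gamma> P \<longleftrightarrow> C1_graph_at \<Gamma> P \<or> C1_graph_at (prod.swap ` \<Gamma>) (prod.swap P)"

text \<open>\<open>C\<^sub>1\<close> and \<open>C\<^sub>2\<close> are the two components of \<open>\<Omega> - \<Gamma>\<close>; each point of
  \<open>\<Gamma> \<inter> \<Omega>\<close> is assigned arbitrarily to one of \<open>\<Omega>\<^sub>1\<close>, \<open>\<Omega>\<^sub>2\<close>.\<close>

definition divides ::
  "(real \<times> real) set \<Rightarrow> (real \<times> real) set \<Rightarrow> (real \<times> real) set \<Rightarrow> (real \<times> real) set \<Rightarrow> bool" where
  "divides \<Gamma> \<Omega> \<Omega>\<^sub>1 \<Omega>\<^sub>2 \<longleftrightarrow>
     (\<exists>C\<^sub>1 C\<^sub>2. C\<^sub>1 \<noteq> C\<^sub>2 \<and> components (\<Omega> - \<Gamma>) = {C\<^sub>1, C\<^sub>2} \<and>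
        \<Gamma> \<inter> \<Omega> \<subseteq> frontier C\<^sub>1 \<and> \<Gamma> \<inter> \<Omega> \<subseteq> frontier C\<^sub>2 \<and>
        C\<^sub>1 \<subseteq> \<Omega>\<^sub>1 \<and> C\<^sub>2 \<subseteq> \<Omega>\<^sub>2 \<and> \<Omega>\<^sub>1 \<union> \<Omega>\<^sub>2 = \<Omega> \<and> \<Omega>\<^sub>1 \<inter> \<Omega>\<^sub>2 = {})"

end

theory Submission
  imports Defs
begin

text \<open>
  The proof is by contraposition. Put \<open>g = f\<^sub>1 - f\<^sub>2\<close>. Every point of the arc inside the disk is a
  limit of points of both components, so the continuity of \<open>F\<close> forces \<open>g = 0\<close> on the arc
  (\<open>glued_agree_on_closure\<close>). Suppose that the gradient of \<open>g\<close> at \<open>P\<close> is not zero. By the idea of the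
  implicit function theorem, the zero set of \<open>g\<close> near \<open>P\<close> is then a \<open>C\<^sup>1\<close> graph, and the arc lies in
  it. Lying in a smooth curve is not yet smoothness; what remains is that the arc fills the
  zero set near \<open>P\<close>. This is where injectivity and the fact that \<open>P\<close> is not an endpoint enter: over
  a short parameter interval around \<open>P\<close>, the abscissa is a continuous injective real function,
  hence an open map, so the arc covers a whole neighbourhood of the abscissa of \<open>P\<close>. Thus the arc
  is smooth at \<open>P\<close> (\<open>arc_in_regular_zero_set_smooth\<close>), contrary to assumption.

  The arc itself supplies the implicit function, so its existence comes for free: what has to be
  shown is that a continuous function whose graph
  consists of zeros of \<open>g\<close> is \<open>C\<^sup>1\<close> (\<open>continuous_zero_curve_C1\<close>) and that a vertical line meets the zero
  set near \<open>P\<close> at most once; both come from the mean value theorem.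

  So the gradients of \<open>f\<^sub>1\<close> and \<open>f\<^sub>2\<close> agree at \<open>P\<close>, and \<open>F\<close>, which at each point of the disk has the value of one of these two
  functions, inherits their common derivative there (\<open>has_derivative_glued\<close>).
\<close>

section \<open>Zero sets of functions with nonvanishing gradient\<close>

lemma mean_value_gradient:
  fixes g :: "'a::real_inner \<Rightarrow> real"
  assumes seg: "closed_segment p q \<subseteq> U"
    and der: "\<And>z. z \<in> U \<Longrightarrow> GDERIV g z :> G z"
  shows "\<exists>\<xi>\<in>closed_segment p q. g q - g p = (q - p) \<bullet> G \<xi>"
proof -
  define l where "l t = p + t *\<^sub>R (q - p)" for t :: real
  have l_seg: "l t \<in> closed_segment p q" if "t \<in> {0..1}" for t
    using that unfolding l_def in_segment
    by (intro exI[of _ t]) (auto simp: algebra_simps)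
  have "(g \<circ> l has_derivative (\<lambda>h. (h *\<^sub>R (q - p)) \<bullet> G (l t))) (at t within {0..1})"
    if "0 \<le> t" "t \<le> 1" for t
  proof -
    have "(l has_derivative (\<lambda>h. h *\<^sub>R (q - p))) (at t within {0..1})"
      unfolding l_def by (auto intro!: derivative_eq_intros)
    moreover have "(g has_derivative (\<lambda>h. h \<bullet> G (l t))) (at (l t))"
      using der[of "l t"] l_seg[of t] seg that unfolding gderiv_def by auto
    ultimately show ?thesis
      unfolding comp_def by (rule has_derivative_compose)
  qed
  then obtain t where "t \<in> {0..1}" and "(g \<circ> l) 1 - (g \<circ> l) 0 = ((1 - 0) *\<^sub>R (q - p)) \<bullet> G (l t)"
    using mvt_very_simple[of 0 1 "g \<circ> l" "\<lambda>t h. (h *\<^sub>R (q - p)) \<bullet> G (l t)"] by auto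
  then show ?thesis
    using l_seg by (intro bexI[of _ "l t"]) (auto simp: l_def)
qed

text \<open>
  The regularity half of the implicit function theorem. The mean value theorem on the chord from
  \<open>(x, \<phi> x)\<close> to \<open>(y, \<phi> y)\<close> gives \<open>0 = (y - x) * g\<^sub>x(\<xi>) + (\<phi> y - \<phi> x) * g\<^sub>y(\<xi>)\<close>, so the difference quotient of \<open>\<phi>\<close>
  equals \<open>- g\<^sub>x(\<xi>) / g\<^sub>y(\<xi>)\<close> exactly. As \<open>y\<close> tends to \<open>x\<close>, the continuity of \<open>\<phi>\<close> shrinks the chord, and
  with it \<open>\<xi>\<close>, to the point \<open>(x, \<phi> x)\<close>. Convexity of \<open>B\<close> keeps the chord where \<open>g\<^sub>y\<close> does not vanish.
\<close>

lemma continuous_zero_curve_C1: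
  fixes g :: "real \<times> real \<Rightarrow> real" and \<phi> :: "real \<Rightarrow> real"
  assumes B: "open B" "convex B"
    and der: "\<And>z. z \<in> B \<Longrightarrow> GDERIV g z :> G z"
    and contG: "continuous_on B G"
    and nz: "\<And>z. z \<in> B \<Longrightarrow> snd (G z) \<noteq> 0"
    and I: "open I" and cont: "continuous_on I \<phi>"
    and graph: "\<And>x. x \<in> I \<Longrightarrow> (x, \<phi> x) \<in> B" and zero: "\<And>x. x \<in> I \<Longrightarrow> g (x, \<phi> x) = 0"
  shows "\<phi> C1_differentiable_on I"
proof -
  define D where "D x = - fst (G (x, \<phi> x)) / snd (G (x, \<phi> x))" for x
  have contGg: "continuous_on I (\<lambda>x. G (x, \<phi> x))"
    by (rule continuous_on_compose2[OF contG])
      (use graph cont in \<open>auto intro!: continuous_intros\<close>)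
  have "continuous_on I D"
    unfolding D_def using contGg graph nz by (auto intro!: continuous_intros)
  moreover have "(\<phi> has_vector_derivative D x) (at x)" if x: "x \<in> I" for x
  proof -
    let ?p = "\<lambda>y. (y, \<phi> y)"
    have "\<exists>\<xi>\<in>closed_segment (?p x) (?p y). g (?p y) - g (?p x) = (?p y - ?p x) \<bullet> G \<xi>"
      if "y \<in> I" for y
    proof -
      have "closed_segment (?p x) (?p y) \<subseteq> B"
        using B(2) graph x that closed_segment_subset by blast
      then show ?thesis
        using der by (rule mean_value_gradient)
    qed
    then have "\<exists>\<xi>. \<forall>y\<in>I. \<xi> y \<in> closed_segment (?p x) (?p y) \<and>
        g (?p y) - g (?p x) = (?p y - ?p x) \<bullet> G (\<xi> y)"
      by (intro bchoice ballI) (simp add: Bex_def)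
    then obtain \<xi> where \<xi>_seg: "\<And>y. y \<in> I \<Longrightarrow> \<xi> y \<in> closed_segment (?p x) (?p y)"
      and \<xi>_eq: "\<And>y. y \<in> I \<Longrightarrow> g (?p y) - g (?p x) = (?p y - ?p x) \<bullet> G (\<xi> y)"
      by blast
    have ev: "\<forall>\<^sub>F y in at x. y \<in> I \<and> y \<noteq> x"
      using I x eventually_at_in_open by force
    have "isCont \<phi> x"
      using cont I x continuous_on_eq_continuous_at by blast
    then have "((\<lambda>y. norm (?p y - ?p x)) \<longlongrightarrow> norm (?p x - ?p x)) (at x)"
      unfolding isCont_def by (intro tendsto_intros)
    then have "((\<lambda>y. norm (?p y - ?p x)) \<longlongrightarrow> 0) (at x)"
      by simp
    then have "((\<lambda>y. \<xi> y - ?p x) \<longlongrightarrow> 0) (at x)"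
    proof (rule Lim_null_comparison[rotated])
      show "\<forall>\<^sub>F y in at x. norm (\<xi> y - ?p x) \<le> norm (?p y - ?p x)"
        using ev by eventually_elim (use \<xi>_seg segment_bound(1) in blast)
    qed
    then have "(\<xi> \<longlongrightarrow> ?p x) (at x)"
      by (simp add: LIM_zero_iff)
    moreover have "isCont G (?p x)"
      using contG B(1) graph x continuous_on_eq_continuous_at by blast
    ultimately have "((\<lambda>y. G (\<xi> y)) \<longlongrightarrow> G (?p x)) (at x)"
      by (rule isCont_tendsto_compose[rotated])
    then have lim: "((\<lambda>y. - fst (G (\<xi> y)) / snd (G (\<xi> y))) \<longlongrightarrow> D x) (at x)"
      unfolding D_def using nz graph x by (intro tendsto_intros) auto
    have "\<forall>\<^sub>F y in at x. - fst (G (\<xi> y)) / snd (G (\<xi> y)) = (\<phi> y - \<phi> x) / (y - x)"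
      using ev
    proof eventually_elim
      case (elim y)
      have "\<xi> y \<in> B"
        using \<xi>_seg[of y] elim closed_segment_subset[of "?p x" B "?p y"] B(2) graph x by blast
      then have "snd (G (\<xi> y)) \<noteq> 0"
        by (rule nz)
      moreover have "(y - x) * fst (G (\<xi> y)) + (\<phi> y - \<phi> x) * snd (G (\<xi> y)) = 0"
        using \<xi>_eq[of y] zero x elim by (simp add: inner_prod_def)
      ultimately show ?case
        using elim by (simp add: field_simps)
    qed
    with lim have "((\<lambda>y. (\<phi> y - \<phi> x) / (y - x)) \<longlongrightarrow> D x) (at x)"
      by (rule Lim_transform_eventually)
    then show ?thesis
      by (simp add: has_field_derivative_iff flip: has_real_derivative_iff_has_vector_derivative)
  qed
  ultimately show ?thesis
    unfolding C1_differentiable_on_def by blast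
qed

text \<open>
  Near \<open>\<gamma> t\<close> a vertical line carries at most one zero of \<open>g\<close>, since \<open>g\<^sub>y \<noteq> 0\<close> there. This has two
  consequences. First, the abscissa \<open>h\<close> is injective on a short parameter interval around \<open>t\<close>; it
  maps that interval homeomorphically onto an open interval \<open>I\<close>, and this piece of the arc is the
  graph of a continuous, hence \<open>C\<^sup>1\<close>, function \<open>\<phi>\<close> on \<open>I\<close>. Second, parts of the arc with
  parameters far from \<open>t\<close> that enter the box \<open>I \<times> J\<close> cannot leave the graph of \<open>\<phi>\<close>.
\<close>

lemma arc_in_regular_zero_set_C1_graph:
  fixes g :: "real \<times> real \<Rightarrow> real" and \<gamma> :: "real \<Rightarrow> real \<times> real"
  assumes cont: "continuous_on {a..b} \<gamma>" and inj: "inj_on \<gamma> {a..b}"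
    and t: "a < t" "t < b" and U: "open U" "\<gamma> t \<in> U"
    and der: "\<And>z. z \<in> U \<Longrightarrow> GDERIV g z :> G z" and contG: "continuous_on U G"
    and zero: "\<And>z. z \<in> \<gamma> ` {a..b} \<inter> U \<Longrightarrow> g z = 0"
    and nz: "snd (G (\<gamma> t)) \<noteq> 0"
  shows "C1_graph_at (\<gamma> ` {a..b}) (\<gamma> t)"
proof -
  define V where "V = {z \<in> U. snd (G z) \<noteq> 0}"
  have "continuous_on U (\<lambda>z. snd (G z))"
    using contG by (intro continuous_intros)
  then have "open (U \<inter> (\<lambda>z. snd (G z)) -` (- {0}))"
    using U(1) by (intro continuous_open_preimage) auto
  moreover have "V = U \<inter> (\<lambda>z. snd (G z)) -` (- {0})"
    unfolding V_def by auto
  ultimately have "open V" "\<gamma> t \<in> V"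
    using U nz by (simp_all add: V_def)
  then obtain A A' where A: "open A" "open A'" "\<gamma> t \<in> A \<times> A'" "A \<times> A' \<subseteq> V"
    by (rule open_prod_elim)
  then obtain e e' where e: "e > 0" "ball (fst (\<gamma> t)) e \<subseteq> A"
    and e': "e' > 0" "ball (snd (\<gamma> t)) e' \<subseteq> A'"
    by (auto simp: mem_Times_iff open_contains_ball) blast
  define J where "J = ball (snd (\<gamma> t)) e'"
  define B where "B = ball (fst (\<gamma> t)) e \<times> J"
  have "B \<subseteq> A \<times> A'"
    using e(2) e'(2) unfolding B_def J_def by (rule Sigma_mono)
  with A(4) have BV: "B \<subseteq> V"
    by blast
  have B: "open B" "convex B" "\<gamma> t \<in> B"
    using e e' by (auto simp: B_def J_def mem_Times_iff intro!: open_Times convex_Times)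
  have B_der: "GDERIV g z :> G z" and B_nz: "snd (G z) \<noteq> 0" if "z \<in> B" for z
  proof -
    have "z \<in> U" "snd (G z) \<noteq> 0"
      using that BV unfolding V_def by blast+
    then show "GDERIV g z :> G z" "snd (G z) \<noteq> 0"
      using der by blast+
  qed
  have contB: "continuous_on B G"
    using BV by (intro continuous_on_subset[OF contG]) (auto simp: V_def)
  have unique: "z = w" if "z \<in> B" "w \<in> B" "g z = 0" "g w = 0" "fst z = fst w" for z w
  proof -
    have seg: "closed_segment z w \<subseteq> B"
      using that B(2) by (simp add: closed_segment_subset)
    then obtain \<xi> where "\<xi> \<in> closed_segment z w" "g w - g z = (w - z) \<bullet> G \<xi>"
      using mean_value_gradient[OF seg B_der] by auto
    then have "\<xi> \<in> B" "(snd w - snd z) * snd (G \<xi>) = 0"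
      using seg that by (auto simp: inner_prod_def)
    with B_nz have "snd w = snd z"
      by auto
    with that show ?thesis
      by (simp add: prod_eq_iff)
  qed
  have "isCont \<gamma> t"
    using cont t by (intro continuous_on_interior[OF cont]) auto
  then have "\<forall>\<^sub>F s in at t. \<gamma> s \<in> B"
    using B by (auto simp: isCont_def intro: topological_tendstoD)
  then obtain d0 where d0: "d0 > 0" "\<And>s. dist s t < d0 \<Longrightarrow> \<gamma> s \<in> B"
    using B(3) unfolding eventually_at by (metis dist_nz UNIV_I)
  \<comment> \<open>Halving \<open>d0\<close> keeps the closed interval \<open>K\<close> inside the open \<open>d0\<close>-neighbourhood of \<open>t\<close>. The compact
    \<open>K\<close> is for the continuity of the inverse of \<open>h\<close>, its interior \<open>T\<close> for the openness of the image.\<close>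
  define d where "d = Min {d0 / 2, t - a, b - t}"
  have d: "d > 0" "d < d0" "d \<le> t - a" "d \<le> b - t"
    using d0(1) t by (auto simp: d_def min_def)
  define K where "K = {t - d..t + d}"
  define T where "T = {t - d<..<t + d}"
  have K: "K \<subseteq> {a..b}" "compact K" "T \<subseteq> K" "t \<in> T" "open T"
    using d by (auto simp: K_def T_def)
  have KB: "\<gamma> s \<in> B" "g (\<gamma> s) = 0" if "s \<in> K" for s
  proof -
    show "\<gamma> s \<in> B"
      using that d by (intro d0(2)) (auto simp: K_def dist_real_def)
    then show "g (\<gamma> s) = 0"
      using that K(1) BV by (intro zero) (auto simp: V_def)
  qed
  define h where "h s = fst (\<gamma> s)" for s
  have h_cont: "continuous_on K h"
    unfolding h_def using continuous_on_subset[OF cont K(1)] by (intro continuous_intros)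
  have h_inj: "inj_on h K"
  proof (rule inj_onI)
    fix s s' assume s: "s \<in> K" "s' \<in> K" "h s = h s'"
    then have "\<gamma> s = \<gamma> s'"
      using unique KB by (simp add: h_def)
    with s inj K(1) show "s = s'"
      by (auto dest: inj_onD)
  qed
  define I where "I = h ` T"
  have I_open: "open I"
    unfolding I_def using K h_cont h_inj by (intro injective_into_1d_imp_open_map_UNIV)
  have "connected T"
    by (simp add: T_def)
  then have "is_interval I"
    unfolding I_def is_interval_connected_1
    using continuous_on_subset[OF h_cont K(3)] by (rule connected_continuous_image[rotated])
  define k where "k = inv_into K h"
  have k_h: "k (h s) = s" if "s \<in> K" for s
    using h_inj that by (simp add: k_def)
  have "continuous_on (h ` K) k"
    using h_cont K(2) k_h by (intro continuous_on_inv) auto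
  then have k_cont: "continuous_on I k"
    using K(3) unfolding I_def by (elim continuous_on_subset) auto
  define \<phi> where "\<phi> x = snd (\<gamma> (k x))" for x
  have k_I: "k x \<in> K" "\<gamma> (k x) = (x, \<phi> x)" if x: "x \<in> I" for x
  proof -
    from x obtain s where s: "s \<in> T" "x = h s"
      unfolding I_def by auto
    then have "k x = s"
      using K(3) k_h by auto
    with s K(3) show "k x \<in> K" "\<gamma> (k x) = (x, \<phi> x)"
      by (auto simp: h_def \<phi>_def prod_eq_iff)
  qed
  have \<phi>_B: "(x, \<phi> x) \<in> B" and \<phi>_zero: "g (x, \<phi> x) = 0" if "x \<in> I" for x
    using k_I[OF that] KB[of "k x"] by simp_all
  have "continuous_on I (\<lambda>x. \<gamma> (k x))"
    by (rule continuous_on_compose2[OF cont k_cont]) (use k_I(1) K(1) in blast)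
  then have "continuous_on I \<phi>"
    unfolding \<phi>_def by (intro continuous_intros)
  then have "\<phi> C1_differentiable_on I"
    using continuous_zero_curve_C1[OF B(1,2) B_der contB B_nz I_open] \<phi>_B \<phi>_zero by blast
  moreover have "k (fst (\<gamma> t)) = t"
    using k_h[of t] K by (auto simp: h_def)
  then have "\<gamma> t = (fst (\<gamma> t), \<phi> (fst (\<gamma> t)))"
    by (simp add: \<phi>_def)
  moreover have "\<gamma> t \<in> I \<times> J"
    using B(3) K(4) by (auto simp: B_def I_def h_def mem_Times_iff)
  moreover have "\<gamma> ` {a..b} \<inter> (I \<times> J) = {(x, \<phi> x) | x. x \<in> I}"
  proof (intro equalityI subsetI)
    fix z assume z: "z \<in> \<gamma> ` {a..b} \<inter> (I \<times> J)"
    then have x: "fst z \<in> I"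
      by (simp add: mem_Times_iff)
    then have "z \<in> B"
      using z \<phi>_B[OF x] by (auto simp: B_def mem_Times_iff)
    moreover from this have "g z = 0"
      using z BV by (intro zero) (auto simp: V_def)
    ultimately have "z = (fst z, \<phi> (fst z))"
      using x \<phi>_B \<phi>_zero by (intro unique) auto
    with x show "z \<in> {(x, \<phi> x) | x. x \<in> I}"
      by blast
  next
    fix z assume "z \<in> {(x, \<phi> x) | x. x \<in> I}"
    then obtain x where x: "x \<in> I" "z = (x, \<phi> x)"
      by blast
    then have "z \<in> \<gamma> ` {a..b}"
      using k_I[OF x(1)] K(1) by (metis image_eqI subsetD)
    with x \<phi>_B[of x] show "z \<in> \<gamma> ` {a..b} \<inter> (I \<times> J)"
      by (auto simp: B_def)
  qed
  moreover have "open J" "is_interval J"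
    by (simp_all add: J_def is_interval_ball_real)
  ultimately show ?thesis
    unfolding C1_graph_at_def using I_open \<open>is_interval I\<close>
    by (intro exI[of _ I] exI[of _ J] exI[of _ \<phi>] conjI)
qed

lemma GDERIV_compose_swap:
  fixes g :: "real \<times> real \<Rightarrow> real"
  assumes "GDERIV g (prod.swap z) :> D"
  shows "GDERIV (g \<circ> prod.swap) z :> prod.swap D"
proof -
  have "(prod.swap has_derivative (prod.swap :: real \<times> real \<Rightarrow> _)) (at z)"
    unfolding prod.swap_def by (auto intro!: derivative_eq_intros)
  from has_derivative_compose[OF this assms[unfolded gderiv_def]]
  show ?thesis
    by (simp add: gderiv_def comp_def inner_prod_def add.commute)
qed

text \<open>
  If \<open>g\<^sub>y\<close> vanishes at the point, then \<open>g\<^sub>x\<close> does not, and interchanging the coordinates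
  turns \<open>g\<^sub>x\<close> into the vertical derivative.
\<close>

lemma arc_in_regular_zero_set_smooth:
  fixes g :: "real \<times> real \<Rightarrow> real" and \<gamma> :: "real \<Rightarrow> real \<times> real"
  assumes cont: "continuous_on {a..b} \<gamma>" and inj: "inj_on \<gamma> {a..b}"
    and t: "a < t" "t < b" and U: "open U" "\<gamma> t \<in> U"
    and der: "\<And>z. z \<in> U \<Longrightarrow> GDERIV g z :> G z" and contG: "continuous_on U G"
    and zero: "\<And>z. z \<in> \<gamma> ` {a..b} \<inter> U \<Longrightarrow> g z = 0"
    and nz: "G (\<gamma> t) \<noteq> 0"
  shows "smooth_at (\<gamma> ` {a..b}) (\<gamma> t)"
proof (cases "snd (G (\<gamma> t)) = 0")
  case False
  then show ?thesis
    using arc_in_regular_zero_set_C1_graph[OF cont inj t U der contG zero]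
    by (simp add: smooth_at_def)
next
  case True
  have swap_cont: "continuous_on S (prod.swap :: real \<times> real \<Rightarrow> _)" for S
    by (rule continuous_on_swap)
  let ?U = "prod.swap -` U"
  have "C1_graph_at ((prod.swap \<circ> \<gamma>) ` {a..b}) ((prod.swap \<circ> \<gamma>) t)"
  proof (rule arc_in_regular_zero_set_C1_graph[where U = ?U and g = "g \<circ> prod.swap"
        and G = "prod.swap \<circ> G \<circ> prod.swap"])
    show "continuous_on {a..b} (prod.swap \<circ> \<gamma>)"
      using cont swap_cont by (rule continuous_on_compose)
    show "inj_on (prod.swap \<circ> \<gamma>) {a..b}"
      using inj by (intro comp_inj_on) auto
    show "open ?U"
      using U(1) swap_cont by (rule open_vimage)
    show "continuous_on ?U (prod.swap \<circ> G \<circ> prod.swap)"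
      by (intro continuous_on_compose swap_cont continuous_on_subset[OF contG]) auto
    show "GDERIV (g \<circ> prod.swap) z :> (prod.swap \<circ> G \<circ> prod.swap) z" if "z \<in> ?U" for z
      using GDERIV_compose_swap[OF der] that by simp
    show "(g \<circ> prod.swap) z = 0" if "z \<in> (prod.swap \<circ> \<gamma>) ` {a..b} \<inter> ?U" for z
    proof -
      have "prod.swap z \<in> \<gamma> ` {a..b} \<inter> U"
        using that by auto
      then show ?thesis
        using zero by simp
    qed
    show "snd ((prod.swap \<circ> G \<circ> prod.swap) ((prod.swap \<circ> \<gamma>) t)) \<noteq> 0"
      using True nz by (simp add: prod_eq_iff)
  qed (use t U in auto)
  then show ?thesis
    by (simp add: smooth_at_def image_comp)
qed

section \<open>Gluing two functions\<close>

text \<open>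
  \<open>F\<close> may switch between \<open>f\<^sub>1\<close> and \<open>f\<^sub>2\<close> arbitrarily: both obey the same linear error bound near \<open>p\<close>.
\<close>

lemma has_derivative_glued:
  fixes f\<^sub>1 f\<^sub>2 F :: "'a::real_normed_vector \<Rightarrow> 'b::real_normed_vector"
  assumes f: "(f\<^sub>1 has_derivative f') (at p)" "(f\<^sub>2 has_derivative f') (at p)"
    and S: "open S" "p \<in> S"
    and F: "\<And>z. z \<in> S \<Longrightarrow> F z = f\<^sub>1 z \<or> F z = f\<^sub>2 z" "F p = f\<^sub>1 p" "F p = f\<^sub>2 p"
  shows "(F has_derivative f') (at p)"
proof -
  have "\<forall>\<^sub>F z in at p. norm (F z - F p - f' (z - p)) \<le> e * norm (z - p)" if "e > 0" for e
  proof -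
    have "\<forall>\<^sub>F z in at p. z \<in> S"
      using S eventually_at_in_open' by blast
    moreover have "\<forall>\<^sub>F z in at p. norm (f\<^sub>1 z - f\<^sub>1 p - f' (z - p)) \<le> e * norm (z - p)"
      "\<forall>\<^sub>F z in at p. norm (f\<^sub>2 z - f\<^sub>2 p - f' (z - p)) \<le> e * norm (z - p)"
      using f that by (auto simp: has_derivative_within_alt2)
    ultimately show ?thesis
      by eventually_elim (use F in metis)
  qed
  then show ?thesis
    using f(1) by (simp add: has_derivative_within_alt2)
qed

lemma glued_agree_on_closure:
  fixes F f :: "'a::t2_space \<Rightarrow> 'b::t2_space"
  assumes "open S" "continuous_on S F" "continuous_on S f"
    and eq: "\<And>z. z \<in> C \<Longrightarrow> F z = f z" and p: "p \<in> S" "p \<in> closure C"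
  shows "F p = f p"
proof (cases "p \<in> C")
  case False
  with p(2) have nontriv: "at p within C \<noteq> bot"
    by (simp add: closure_def trivial_limit_within)
  have "isCont F p" "isCont f p"
    using assms continuous_on_eq_continuous_at by blast+
  then have "(F \<longlongrightarrow> F p) (at p within C)" "(f \<longlongrightarrow> f p) (at p within C)"
    by (auto simp: isCont_def intro: tendsto_within_subset)
  moreover from this(1) have "(f \<longlongrightarrow> F p) (at p within C)"
    by (rule Lim_transform_eventually) (auto simp: eventually_at_filter eq)
  ultimately show ?thesis
    using nontriv tendsto_unique by blast
qed (use eq in simp)

section \<open>Gluing along a non-smooth arc\<close>

theorem theorem3:
  fixes \<Omega> \<Omega>\<^sub>1 \<Omega>\<^sub>2 :: "(real \<times> real) set"
    and c P :: "real \<times> real"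
    and r a b :: real
    and \<gamma> :: "real \<Rightarrow> real \<times> real"
    and f\<^sub>1 f\<^sub>2 F :: "real \<times> real \<Rightarrow> real"
  assumes "r > 0" and "\<Omega> = ball c r"
    and "a < b" and "continuous_on {a..b} \<gamma>" and "inj_on \<gamma> {a..b}"
    and "divides (\<gamma> ` {a..b}) \<Omega> \<Omega>\<^sub>1 \<Omega>\<^sub>2"
    and "P \<in> \<gamma> ` {a..b} \<inter> \<Omega>" and "P \<noteq> \<gamma> a" and "P \<noteq> \<gamma> b"
    and "\<not> smooth_at (\<gamma> ` {a..b}) P"
    and "C1_on f\<^sub>1 \<Omega>" and "C1_on f\<^sub>2 \<Omega>"
    and "\<And>p. p \<in> \<Omega>\<^sub>1 \<Longrightarrow> F p = f\<^sub>1 p"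
    and "\<And>p. p \<in> \<Omega>\<^sub>2 \<Longrightarrow> F p = f\<^sub>2 p"
    and "continuous_on \<Omega> F"
  shows "F differentiable (at P) \<and> gradient f\<^sub>1 P = gradient f\<^sub>2 P"
proof -
  have \<Omega>_open: "open \<Omega>"
    using assms(2) by simp
  from assms(6) obtain C\<^sub>1 C\<^sub>2 where
    C: "\<gamma> ` {a..b} \<inter> \<Omega> \<subseteq> frontier C\<^sub>1" "\<gamma> ` {a..b} \<inter> \<Omega> \<subseteq> frontier C\<^sub>2"
      "C\<^sub>1 \<subseteq> \<Omega>\<^sub>1" "C\<^sub>2 \<subseteq> \<Omega>\<^sub>2" and cover: "\<Omega>\<^sub>1 \<union> \<Omega>\<^sub>2 = \<Omega>"
    unfolding divides_def by blast
  from assms(11) obtain G\<^sub>1 where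
    G1: "\<And>z. z \<in> \<Omega> \<Longrightarrow> GDERIV f\<^sub>1 z :> G\<^sub>1 z" "continuous_on \<Omega> G\<^sub>1"
    unfolding C1_on_def by blast
  from assms(12) obtain G\<^sub>2 where
    G2: "\<And>z. z \<in> \<Omega> \<Longrightarrow> GDERIV f\<^sub>2 z :> G\<^sub>2 z" "continuous_on \<Omega> G\<^sub>2"
    unfolding C1_on_def by blast
  have f_cont: "continuous_on \<Omega> f\<^sub>1" "continuous_on \<Omega> f\<^sub>2"
    using G1(1) G2(1) unfolding gderiv_def
    by (auto intro!: continuous_at_imp_continuous_on has_derivative_continuous)
  have agree: "F z = f\<^sub>1 z" "F z = f\<^sub>2 z" if "z \<in> \<gamma> ` {a..b} \<inter> \<Omega>" for z
  proof -
    have "z \<in> closure C\<^sub>1" "z \<in> closure C\<^sub>2" "z \<in> \<Omega>"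
      using that C(1,2) by (auto simp: frontier_def)
    then show "F z = f\<^sub>1 z" "F z = f\<^sub>2 z"
      using glued_agree_on_closure[OF \<Omega>_open assms(15)] f_cont assms(13,14) C(3,4) by blast+
  qed
  obtain t where t: "t \<in> {a..b}" "P = \<gamma> t"
    using assms(7) by auto
  then have t_inner: "a < t" "t < b"
    using assms(8,9) by (auto simp: less_le)
  define G where "G z = G\<^sub>1 z - G\<^sub>2 z" for z
  have "G P = 0"
  proof (rule ccontr)
    assume "G P \<noteq> 0"
    have "smooth_at (\<gamma> ` {a..b}) (\<gamma> t)"
    proof (rule arc_in_regular_zero_set_smooth[OF assms(4,5) t_inner \<Omega>_open,
          where g = "\<lambda>z. f\<^sub>1 z - f\<^sub>2 z"])
      show "GDERIV (\<lambda>z. f\<^sub>1 z - f\<^sub>2 z) z :> G z" if "z \<in> \<Omega>" for z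
        unfolding G_def using G1(1) G2(1) that by (intro GDERIV_diff)
      show "continuous_on \<Omega> G"
        unfolding G_def using G1(2) G2(2) by (intro continuous_intros)
      show "f\<^sub>1 z - f\<^sub>2 z = 0" if "z \<in> \<gamma> ` {a..b} \<inter> \<Omega>" for z
        using agree[OF that] by simp
    qed (use assms(7) t \<open>G P \<noteq> 0\<close> in auto)
    with assms(10) t show False
      by simp
  qed
  then have eq: "G\<^sub>1 P = G\<^sub>2 P"
    by (simp add: G_def)
  have "P \<in> \<Omega>"
    using assms(7) by simp
  with G1(1) G2(1) eq have der: "GDERIV f\<^sub>1 P :> G\<^sub>1 P" "GDERIV f\<^sub>2 P :> G\<^sub>1 P"
    by metis+
  then have "gradient f\<^sub>1 P = gradient f\<^sub>2 P"
    by (simp add: gradient_eqI)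
  moreover have "(F has_derivative (\<lambda>h. h \<bullet> G\<^sub>1 P)) (at P)"
  proof (rule has_derivative_glued)
    show "F z = f\<^sub>1 z \<or> F z = f\<^sub>2 z" if "z \<in> \<Omega>" for z
      using that cover assms(13,14) by blast
  qed (use der \<Omega>_open \<open>P \<in> \<Omega>\<close> agree assms(7) in \<open>auto simp: gderiv_def\<close>)
  ultimately show ?thesis
    unfolding differentiable_def by blast
qed

end
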